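(* Let $\Gamma\subset\mathbb C$ be a positively oriented simple closed $C^1$ contour containing none of the nodes $\rho_1(q),\dots,\rho_r(q)$. Then the number $N_q(\Gamma)$ of nodes in the interior of $\Gamma$, counted with multiplicity, is $$N_q(\Gamma)=\frac{1}{2\pi i}\int_\Gamma\frac{\Psi_q'(z)}{\Psi_q(z)}\,dz=-\frac{1}{2\pi i}\int_\Gamma\operatorname{tr}\!\left(A_q(z)^{-1}H_{r,0}^{(q)}\right)dz.$$
   Context: Let $r\ge1$, $q\in(0,1)$, $\alpha_1,\dots,\alpha_r\in\mathbb C$, $w_1,\dots,w_r\in\mathbb C\setminus\{0\}$, with nodes $\rho_\ell(q)=q^{\alpha_\ell}=e^{\alpha_\ell\log q}$ assumed pairwise distinct. Put $\mu_n^{(q)}=\sum_{\ell=1}^r w_\ell\rho_\ell(q)^n$ for $n\ge0$ and $H_{r,s}^{(q)}=(\mu_{i+j+s}^{(q)})_{i,j=0}^{r-1}$ for $s=0,1$. The minimal Hankel pencil and its characteristic are $A_q(z)=H_{r,1}^{(q)}-zH_{r,0}^{(q)}$ and $\Psi_q(z)=\det A_q(z)$. *)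

theory Defs
  imports
    "HOL-Complex_Analysis.Complex_Analysis"
    "Jordan_Normal_Form.Determinant"
    "Jordan_Normal_Form.Gauss_Jordan_Elimination"
begin

text \<open>
  HOL-Analysis also has constants \<open>det\<close> and \<open>trace\<close>, for matrices indexed by finite types.
  The matrices here are those of Jordan_Normal_Form, whose index range starts at 0;
  its determinant is therefore written \<open>Determinant.det\<close>.
\<close>

definition node :: "real \<Rightarrow> (nat \<Rightarrow> complex) \<Rightarrow> nat \<Rightarrow> complex" where
  "node q \<alpha> l = exp (\<alpha> l * complex_of_real (ln q))"

definition moment :: "nat \<Rightarrow> real \<Rightarrow> (nat \<Rightarrow> complex) \<Rightarrow> (nat \<Rightarrow> complex) \<Rightarrow> nat \<Rightarrow> complex" where
  "moment r q \<alpha> w n = (\<Sum>l = 1..r. w l * node q \<alpha> l ^ n)"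

definition hankel ::
    "nat \<Rightarrow> real \<Rightarrow> (nat \<Rightarrow> complex) \<Rightarrow> (nat \<Rightarrow> complex) \<Rightarrow> nat \<Rightarrow> complex mat" where
  "hankel r q \<alpha> w s = mat r r (\<lambda>(i, j). moment r q \<alpha> w (i + j + s))"

definition pencil ::
    "nat \<Rightarrow> real \<Rightarrow> (nat \<Rightarrow> complex) \<Rightarrow> (nat \<Rightarrow> complex) \<Rightarrow> complex \<Rightarrow> complex mat" where
  "pencil r q \<alpha> w z = hankel r q \<alpha> w 1 - z \<cdot>\<^sub>m hankel r q \<alpha> w 0"

definition pencil_char ::
    "nat \<Rightarrow> real \<Rightarrow> (nat \<Rightarrow> complex) \<Rightarrow> (nat \<Rightarrow> complex) \<Rightarrow> complex \<Rightarrow> complex" where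
  "pencil_char r q \<alpha> w z = Determinant.det (pencil r q \<alpha> w z)"

definition mat_trace :: "'a::comm_monoid_add mat \<Rightarrow> 'a" where
  "mat_trace A = (\<Sum>i<dim_row A. A $$ (i, i))"

text \<open>
  \<open>mat_inverse\<close> returns an option; the value below is meaningful only for invertible \<open>A\<close>.
\<close>

definition mat_inv :: "'a::field mat \<Rightarrow> 'a mat" where
  "mat_inv A = the (mat_inverse A)"

text \<open>
  The derivatives at the endpoints 0 and 1 are one-sided, so that nothing is required of \<open>\<gamma>\<close>
  outside the unit interval (\<open>C1_differentiable_on\<close> uses two-sided derivatives).
\<close>

definition C1_path :: "(real \<Rightarrow> complex) \<Rightarrow> bool" where
  "C1_path \<gamma> \<longleftrightarrow>
     (\<exists>D. continuous_on {0..1} D \<and>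
          (\<forall>t\<in>{0..1}. (\<gamma> has_vector_derivative D t) (at t within {0..1})))"

text \<open>
  The winding number of a simple closed path is constant on the interior, with value 1 or -1,
  so one interior point determines the orientation.
\<close>

definition positively_oriented :: "(real \<Rightarrow> complex) \<Rightarrow> bool" where
  "positively_oriented \<gamma> \<longleftrightarrow> (\<exists>z\<in>inside (path_image \<gamma>). winding_number \<gamma> z = 1)"

text \<open>Indices are counted, so a value taken by several nodes would count that many times.\<close>

definition nodes_inside ::
    "nat \<Rightarrow> real \<Rightarrow> (nat \<Rightarrow> complex) \<Rightarrow> (real \<Rightarrow> complex) \<Rightarrow> nat" where
  "nodes_inside r q \<alpha> \<gamma> = card {l \<in> {1..r}. node q \<alpha> l \<in> inside (path_image \<gamma>)}"

end

theory Submission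
  imports Defs
begin

text \<open>
  The moments are power sums of the nodes, so both Hankel matrices are congruent to diagonal
  matrices through one and the same Vandermonde matrix \<open>V\<close> of the nodes: \<open>H\<^sub>s = V D\<^sub>s V\<^sup>T\<close> with
  \<open>D\<^sub>s = diag (w\<^sub>l \<rho>\<^sub>l\<^sup>s)\<close>. Hence the pencil is \<open>A(z) = V diag (w\<^sub>l (\<rho>\<^sub>l - z)) V\<^sup>T\<close>, and everything
  about it is read off from this simultaneous diagonalisation
  (\<open>hankel_factorisation\<close>, \<open>pencil_factorisation\<close>).

  Distinct nodes make \<open>V\<close> invertible (\<open>det_vandermonde_nonzero\<close>), and the weights are nonzero, so
  the characteristic \<open>\<Psi>(z) = (det V)\<^sup>2 \<Prod>\<^sub>l w\<^sub>l (\<rho>\<^sub>l - z)\<close> vanishes exactly at the nodes and its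
  logarithmic derivative is \<open>\<Sum>\<^sub>l 1 / (z - \<rho>\<^sub>l)\<close>. On the other side, \<open>A(z)\<^sup>-\<^sup>1 H\<^sub>0\<close> is similar to
  \<open>diag (1 / (\<rho>\<^sub>l - z))\<close>, so its trace is the negative of that same sum
  (\<open>mat_trace_inverse_congruent_diag\<close>). Both integrands are thus explicit sums of simple fractions,
  and each fraction contributes \<open>2\<pi>\<i>\<close> times the winding number of the contour around its node,
  which is 1 inside a positively oriented simple closed contour and 0 outside.
\<close>

section \<open>Vandermonde matrices\<close>

definition vandermonde :: "nat \<Rightarrow> (nat \<Rightarrow> 'a::comm_ring_1) \<Rightarrow> 'a mat" where
  "vandermonde n x = Matrix.mat n n (\<lambda>(i, l). x l ^ i)"

lemma vandermonde_carrier [simp]: "vandermonde n x \<in> carrier_mat n n"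
  by (simp add: vandermonde_def)

text \<open>
  A vector in the kernel of the transpose is the coefficient vector of a polynomial of degree less
  than \<open>n\<close> that vanishes at \<open>n\<close> distinct points.
\<close>

lemma det_vandermonde_nonzero:
  fixes x :: "nat \<Rightarrow> 'a::field"
  assumes inj: "inj_on x {..<n}"
  shows "Determinant.det (vandermonde n x) \<noteq> 0"
proof
  assume "Determinant.det (vandermonde n x) = 0"
  hence "Determinant.det (transpose_mat (vandermonde n x)) = 0"
    by (simp add: det_transpose[OF vandermonde_carrier])
  then obtain v where v: "v \<in> carrier_vec n" "v \<noteq> 0\<^sub>v n"
    and ker: "transpose_mat (vandermonde n x) *\<^sub>v v = 0\<^sub>v n"
    using det_0_iff_vec_prod_zero_field[of "transpose_mat (vandermonde n x)" n] by auto
  define p where "p = (\<Sum>i<n. monom (vec_index v i) i)"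
  have coeff_p: "coeff p k = (if k < n then vec_index v k else 0)" for k
    by (simp add: p_def coeff_sum)
  have root: "poly p (x l) = 0" if "l < n" for l
  proof -
    have "poly p (x l) = vec_index (transpose_mat (vandermonde n x) *\<^sub>v v) l"
      using that v(1)
      by (auto simp: p_def poly_sum poly_monom vandermonde_def scalar_prod_def mult.commute
          atLeast0LessThan intro!: sum.cong)
    thus ?thesis using ker that by simp
  qed
  have "p = 0"
  proof (rule ccontr)
    assume "p \<noteq> 0"
    hence "card {y. poly p y = 0} \<le> degree p"
      by (rule card_poly_roots_bound)
    moreover have "n \<le> card {y. poly p y = 0}"
    proof -
      have "card (x ` {..<n}) \<le> card {y. poly p y = 0}"
        using root \<open>p \<noteq> 0\<close> by (intro card_mono poly_roots_finite) auto
      thus ?thesis by (simp add: card_image inj)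
    qed
    moreover have "degree p < n"
      using coeff_p[of "degree p"] \<open>p \<noteq> 0\<close> by (auto split: if_splits)
    ultimately show False by simp
  qed
  hence "vec_index v k = 0" if "k < n" for k
    using coeff_p[of k] that by simp
  hence "v = 0\<^sub>v n"
    using v(1) by (intro eq_vecI) auto
  thus False using v(2) by simp
qed

text \<open>
  The entry at \<open>(i, j)\<close> is a power sum that depends on \<open>i + j\<close> only: this is why Hankel matrices of
  moments have such a factorisation.
\<close>

lemma vandermonde_diag_transpose:
  "vandermonde n x * mat_diag n c * transpose_mat (vandermonde n x) =
     Matrix.mat n n (\<lambda>(i, j). \<Sum>l<n. c l * x l ^ (i + j))"
proof -
  have "vandermonde n x * mat_diag n c = Matrix.mat n n (\<lambda>(i, l). c l * x l ^ i)"
    by (subst mat_diag_mult_right[OF vandermonde_carrier])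
       (auto simp: vandermonde_def intro!: eq_matI)
  thus ?thesis
    by (auto simp: vandermonde_def scalar_prod_def power_add atLeast0LessThan mult.assoc
        intro!: eq_matI sum.cong)
qed

section \<open>Traces and inverses\<close>

lemma mat_trace_mult_commute:
  fixes A B :: "'a::comm_semiring_0 mat"
  assumes "A \<in> carrier_mat n m" "B \<in> carrier_mat m n"
  shows "mat_trace (A * B) = mat_trace (B * A)"
proof -
  have "mat_trace (A * B) = (\<Sum>i<n. \<Sum>k<m. A $$ (i, k) * B $$ (k, i))"
    using assms by (auto simp: mat_trace_def scalar_prod_def atLeast0LessThan)
  also have "\<dots> = (\<Sum>k<m. \<Sum>i<n. B $$ (k, i) * A $$ (i, k))"
    by (subst sum.swap) (simp add: mult.commute)
  also have "\<dots> = mat_trace (B * A)"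
    using assms by (auto simp: mat_trace_def scalar_prod_def atLeast0LessThan)
  finally show ?thesis .
qed

lemma mat_inv_inverse:
  assumes A: "A \<in> carrier_mat n n" and det: "Determinant.det A \<noteq> 0"
  shows "A * mat_inv A = 1\<^sub>m n" "mat_inv A * A = 1\<^sub>m n" "mat_inv A \<in> carrier_mat n n"
proof -
  obtain B where "mat_inverse A = Some B"
    using mat_inverse(1)[OF A, of "()"] det_non_zero_imp_unit[OF A det, of "()"]
    by (cases "mat_inverse A") auto
  thus "A * mat_inv A = 1\<^sub>m n" "mat_inv A * A = 1\<^sub>m n" "mat_inv A \<in> carrier_mat n n"
    using mat_inverse(2)[OF A] by (auto simp: mat_inv_def)
qed

text \<open>
  If \<open>V\<close> diagonalises two symmetric matrices by congruence at once, then the inverse of the first times the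
  second is \<open>(V\<^sup>T)\<^sup>-\<^sup>1 D\<^sup>-\<^sup>1 C V\<^sup>T\<close>, with \<open>D = diag d\<close> and \<open>C = diag c\<close>, which is
  similar to the diagonal matrix of the quotients.
  The inverse of \<open>V\<^sup>T\<close> need not be constructed: since \<open>B\<close> inverts \<open>V D V\<^sup>T\<close>, it is \<open>B V D\<close>.
\<close>

lemma mat_trace_inverse_congruent_diag:
  fixes V :: "'a::field mat"
  assumes V: "V \<in> carrier_mat n n" and d: "\<And>l. l < n \<Longrightarrow> d l \<noteq> 0"
    and B: "B \<in> carrier_mat n n"
    and inv: "B * (V * mat_diag n d * transpose_mat V) = 1\<^sub>m n"
  shows "mat_trace (B * (V * mat_diag n c * transpose_mat V)) = (\<Sum>l<n. c l / d l)"
proof -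
  define T where "T = transpose_mat V"
  define X where "X = B * V * mat_diag n d"
  have [simp]: "T \<in> carrier_mat n n" "X \<in> carrier_mat n n"
    using V B by (auto simp: T_def X_def intro!: mult_carrier_mat)
  have diag: "mat_diag n d * mat_diag n (\<lambda>l. c l / d l) = mat_diag n c"
    unfolding mat_diag_diag using d by (auto simp: mat_diag_def intro!: eq_matI)
  have XT: "X * T = 1\<^sub>m n"
    using inv V B by (simp add: X_def T_def assoc_mult_mat[of _ n n _ n _ n])
  have TX: "T * X = 1\<^sub>m n"
    by (rule mat_mult_left_right_inverse[OF _ _ XT]) auto
  have "B * (V * mat_diag n c * T) = X * (mat_diag n (\<lambda>l. c l / d l) * T)"
    using V B
    by (simp add: X_def T_def diag[symmetric] assoc_mult_mat[of _ n n _ n _ n]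
        mult_carrier_mat[of _ n n _ n] del: mat_diag_diag)
  also have "mat_trace \<dots> = mat_trace ((mat_diag n (\<lambda>l. c l / d l) * T) * X)"
    by (rule mat_trace_mult_commute[of _ n n]) (auto intro: mult_carrier_mat[of _ n n])
  also have "(mat_diag n (\<lambda>l. c l / d l) * T) * X = mat_diag n (\<lambda>l. c l / d l)"
    by (simp add: assoc_mult_mat[of _ n n _ n _ n] TX right_mult_one_mat[of _ n n])
  also have "mat_trace \<dots> = (\<Sum>l<n. c l / d l)"
    by (simp add: mat_trace_def mat_diag_def)
  finally show ?thesis by (simp add: T_def)
qed

section \<open>The Hankel pencil in terms of its nodes\<close>

text \<open>
  Nodes are numbered from 1 but matrix indices from 0, whence the composition with \<open>Suc\<close>.
\<close>

lemma hankel_factorisation: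
  "hankel r q \<alpha> w s =
     vandermonde r (node q \<alpha> \<circ> Suc) * mat_diag r (\<lambda>l. w (Suc l) * node q \<alpha> (Suc l) ^ s) *
     transpose_mat (vandermonde r (node q \<alpha> \<circ> Suc))"
  unfolding vandermonde_diag_transpose
  by (auto simp: hankel_def moment_def sum.atLeast1_atMost_eq power_add mult_ac
      intro!: eq_matI sum.cong)

lemma pencil_factorisation:
  "pencil r q \<alpha> w z =
     vandermonde r (node q \<alpha> \<circ> Suc) * mat_diag r (\<lambda>l. w (Suc l) * (node q \<alpha> (Suc l) - z)) *
     transpose_mat (vandermonde r (node q \<alpha> \<circ> Suc))"
  unfolding vandermonde_diag_transpose pencil_def
  by (auto simp: hankel_def moment_def sum.atLeast1_atMost_eq sum_distrib_left
      algebra_simps sum_subtractf[symmetric] intro!: eq_matI sum.cong)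

lemma pencil_carrier: "pencil r q \<alpha> w z \<in> carrier_mat r r"
  unfolding pencil_def hankel_def by (intro minus_carrier_mat smult_carrier_mat mat_carrier)

lemma pencil_char_product:
  "pencil_char r q \<alpha> w z =
     (Determinant.det (vandermonde r (node q \<alpha> \<circ> Suc)))\<^sup>2 *
     (\<Prod>l = 1..r. w l * (node q \<alpha> l - z))"
proof -
  define V where "V = vandermonde r (node q \<alpha> \<circ> Suc)"
  define D where "D = mat_diag r (\<lambda>l. w (Suc l) * (node q \<alpha> (Suc l) - z))"
  have V: "V \<in> carrier_mat r r" and D: "D \<in> carrier_mat r r"
    by (auto simp: V_def D_def)
  have "Determinant.det D = prod_list (diag_mat D)"
    by (rule det_upper_triangular[OF _ D]) (auto simp: D_def mat_diag_def)
  also have "\<dots> = (\<Prod>l = 1..r. w l * (node q \<alpha> l - z))"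
    by (simp add: prod_list_diag_prod D_def mat_diag_def prod.atLeast1_atMost_eq atLeast0LessThan)
  finally have det_D: "Determinant.det D = (\<Prod>l = 1..r. w l * (node q \<alpha> l - z))" .
  have "pencil_char r q \<alpha> w z = Determinant.det (V * D * transpose_mat V)"
    by (simp add: pencil_char_def pencil_factorisation V_def D_def)
  also have "\<dots> = Determinant.det V * Determinant.det D * Determinant.det V"
    using V D by (simp add: det_mult[of _ r] det_transpose)
  finally show ?thesis
    by (simp add: det_D V_def power2_eq_square mult_ac)
qed

lemma pencil_char_nonzero:
  assumes w: "\<And>l. l \<in> {1..r} \<Longrightarrow> w l \<noteq> 0"
    and inj: "inj_on (node q \<alpha>) {1..r}"
    and z: "\<And>l. l \<in> {1..r} \<Longrightarrow> z \<noteq> node q \<alpha> l"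
  shows "pencil_char r q \<alpha> w z \<noteq> 0"
proof -
  have "inj_on (node q \<alpha> \<circ> Suc) {..<r}"
    using inj by (intro comp_inj_on) (auto simp: image_Suc_lessThan)
  hence "Determinant.det (vandermonde r (node q \<alpha> \<circ> Suc)) \<noteq> 0"
    by (rule det_vandermonde_nonzero)
  thus ?thesis
    using w z by (force simp: pencil_char_product)
qed

lemma pencil_char_logderiv:
  assumes "pencil_char r q \<alpha> w z \<noteq> 0"
  shows "deriv (pencil_char r q \<alpha> w) z / pencil_char r q \<alpha> w z =
           (\<Sum>l = 1..r. 1 / (z - node q \<alpha> l))"
proof -
  define C where "C = (Determinant.det (vandermonde r (node q \<alpha> \<circ> Suc)))\<^sup>2"
  have eq: "pencil_char r q \<alpha> w = (\<lambda>u. C * (\<Prod>l = 1..r. w l * (node q \<alpha> l - u)))"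
    by (rule ext) (simp add: C_def pencil_char_product)
  have nz: "w l * (node q \<alpha> l - z) \<noteq> 0" if "l \<in> {1..r}" for l
    using assms that by (auto simp: eq)
  have "((\<lambda>u. \<Prod>l = 1..r. w l * (node q \<alpha> l - u)) has_field_derivative
          (\<Prod>l = 1..r. w l * (node q \<alpha> l - z)) *
          (\<Sum>l = 1..r. - w l / (w l * (node q \<alpha> l - z)))) (at z)"
    using nz by (intro has_field_derivative_prod') (auto intro!: derivative_eq_intros)
  hence "(pencil_char r q \<alpha> w has_field_derivative
          pencil_char r q \<alpha> w z * (\<Sum>l = 1..r. - w l / (w l * (node q \<alpha> l - z)))) (at z)"
    unfolding eq by (auto dest: DERIV_cmult[where c = C] simp: mult.assoc)
  hence "deriv (pencil_char r q \<alpha> w) z / pencil_char r q \<alpha> w z =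
           (\<Sum>l = 1..r. - w l / (w l * (node q \<alpha> l - z)))"
    using assms by (simp add: DERIV_imp_deriv)
  also have "\<dots> = (\<Sum>l = 1..r. 1 / (z - node q \<alpha> l))"
    using nz by (intro sum.cong refl) (auto simp: divide_simps)
  finally show ?thesis .
qed

text \<open>
  By Jacobi's formula this is the logarithmic derivative up to sign, because \<open>H\<^sub>0\<close> is minus the
  derivative of the pencil. Here both sides are instead compared with the same sum of fractions.
\<close>

lemma trace_inverse_pencil_times_hankel:
  assumes nz: "pencil_char r q \<alpha> w z \<noteq> 0"
  shows "mat_trace (mat_inv (pencil r q \<alpha> w z) * hankel r q \<alpha> w 0) =
           - (\<Sum>l = 1..r. 1 / (z - node q \<alpha> l))"
proof -
  have nz': "w l * (node q \<alpha> l - z) \<noteq> 0" if "l \<in> {1..r}" for l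
    using nz that by (auto simp: pencil_char_product)
  note inv = mat_inv_inverse[OF pencil_carrier nz[unfolded pencil_char_def]]
  have "mat_trace (mat_inv (pencil r q \<alpha> w z) * hankel r q \<alpha> w 0) =
          (\<Sum>l<r. w (Suc l) * node q \<alpha> (Suc l) ^ 0 / (w (Suc l) * (node q \<alpha> (Suc l) - z)))"
    unfolding hankel_factorisation
    by (rule mat_trace_inverse_congruent_diag[OF vandermonde_carrier _ inv(3)])
       (use nz' inv(2) in \<open>auto simp flip: pencil_factorisation\<close>)
  also have "\<dots> = (\<Sum>l = 1..r. w l / (w l * (node q \<alpha> l - z)))"
    by (simp add: sum.atLeast1_atMost_eq)
  also have "\<dots> = - (\<Sum>l = 1..r. 1 / (z - node q \<alpha> l))"
    unfolding sum_negf[symmetric]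
    using nz' by (intro sum.cong refl) (auto simp: divide_simps)
  finally show ?thesis .
qed

section \<open>Winding numbers of the contour\<close>

text \<open>
  A valid path is required to have a two-sided derivative only outside a finite set, so the two
  endpoints, where just a one-sided derivative is given, can be put into that set.
\<close>

lemma C1_path_imp_valid_path:
  assumes "C1_path \<gamma>"
  shows "valid_path \<gamma>"
proof -
  obtain D where D: "continuous_on {0..1} D"
    and deriv: "\<And>t. t \<in> {0..1} \<Longrightarrow> (\<gamma> has_vector_derivative D t) (at t within {0..1})"
    using assms unfolding C1_path_def by blast
  have "(\<gamma> has_vector_derivative D t) (at t)" if "t \<in> {0..1} - {0, 1}" for t
    using deriv[of t] that by (simp add: at_within_Icc_at)
  hence "\<gamma> C1_differentiable_on ({0..1} - {0, 1})"
    unfolding C1_differentiable_on_def using continuous_on_subset[OF D] by blast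
  moreover have "continuous_on {0..1} \<gamma>"
    using deriv by (intro continuous_on_vector_derivative)
  ultimately show ?thesis
    unfolding valid_path_def piecewise_C1_differentiable_on_def
    by (metis finite.emptyI finite.insertI)
qed

text \<open>
  The winding number around all interior points is 1, or around all of them -1; the interior point
  that witnesses the orientation excludes the latter.
\<close>

lemma winding_number_positively_oriented:
  assumes "simple_path \<gamma>" "pathfinish \<gamma> = pathstart \<gamma>" "positively_oriented \<gamma>"
    and "z \<notin> path_image \<gamma>"
  shows "winding_number \<gamma> z = (if z \<in> inside (path_image \<gamma>) then 1 else 0)"
proof (cases "z \<in> inside (path_image \<gamma>)")
  case True
  obtain u where u: "u \<in> inside (path_image \<gamma>)" "winding_number \<gamma> u = 1"
    using assms(3) unfolding positively_oriented_def by blast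
  from assms(1) show ?thesis
  proof (rule simple_closed_path_winding_number_inside)
    assume "\<And>z. z \<in> inside (path_image \<gamma>) \<Longrightarrow> winding_number \<gamma> z = 1"
    thus ?thesis using True by simp
  next
    assume "\<And>z. z \<in> inside (path_image \<gamma>) \<Longrightarrow> winding_number \<gamma> z = -1"
    from this[OF u(1)] u(2) show ?thesis by simp
  qed
next
  case False
  hence "z \<in> outside (path_image \<gamma>)"
    using assms(4) inside_Un_outside[of "path_image \<gamma>"] by blast
  thus ?thesis
    using False assms by (simp add: winding_number_zero_in_outside simple_path_imp_path)
qed

section \<open>Counting the nodes\<close>

lemma has_contour_integral_sum_inverse:
  assumes "valid_path \<gamma>" "finite I"
    and "\<And>i. i \<in> I \<Longrightarrow> a i \<notin> path_image \<gamma>"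
  shows "((\<lambda>z. \<Sum>i\<in>I. 1 / (z - a i)) has_contour_integral
           2 * pi * \<i> * (\<Sum>i\<in>I. winding_number \<gamma> (a i))) \<gamma>"
  unfolding sum_distrib_left using assms
  by (intro has_contour_integral_sum has_contour_integral_winding_number)

theorem proposition4p2:
  fixes r :: nat and q :: real and \<alpha> w :: "nat \<Rightarrow> complex" and \<gamma> :: "real \<Rightarrow> complex"
  assumes "r \<ge> 1"
    and "0 < q" and "q < 1"
    and "\<And>l. l \<in> {1..r} \<Longrightarrow> w l \<noteq> 0"
    and "inj_on (node q \<alpha>) {1..r}"
    and "C1_path \<gamma>" and "simple_path \<gamma>" and "pathfinish \<gamma> = pathstart \<gamma>"
    and "positively_oriented \<gamma>"
    and "\<And>l. l \<in> {1..r} \<Longrightarrow> node q \<alpha> l \<notin> path_image \<gamma>"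
  shows "(\<forall>z\<in>path_image \<gamma>. pencil_char r q \<alpha> w z \<noteq> 0 \<and> invertible_mat (pencil r q \<alpha> w z))
    \<and> (\<lambda>z. deriv (pencil_char r q \<alpha> w) z / pencil_char r q \<alpha> w z) contour_integrable_on \<gamma>
    \<and> (\<lambda>z. mat_trace (mat_inv (pencil r q \<alpha> w z) * hankel r q \<alpha> w 0)) contour_integrable_on \<gamma>
    \<and> of_nat (nodes_inside r q \<alpha> \<gamma>) =
        1 / (2 * complex_of_real pi * \<i>) *
          contour_integral \<gamma> (\<lambda>z. deriv (pencil_char r q \<alpha> w) z / pencil_char r q \<alpha> w z)
    \<and> 1 / (2 * complex_of_real pi * \<i>) *
          contour_integral \<gamma> (\<lambda>z. deriv (pencil_char r q \<alpha> w) z / pencil_char r q \<alpha> w z) =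
        - (1 / (2 * complex_of_real pi * \<i>)) *
          contour_integral \<gamma> (\<lambda>z. mat_trace (mat_inv (pencil r q \<alpha> w z) * hankel r q \<alpha> w 0))"
proof -
  let ?P = "pencil_char r q \<alpha> w"
  let ?S = "\<lambda>z. \<Sum>l = 1..r. 1 / (z - node q \<alpha> l)"
  let ?N = "nodes_inside r q \<alpha> \<gamma>"
  let ?T = "\<lambda>z. mat_trace (mat_inv (pencil r q \<alpha> w z) * hankel r q \<alpha> w 0)"
  have nz: "?P z \<noteq> 0" if "z \<in> path_image \<gamma>" for z
    using assms(10) that by (intro pencil_char_nonzero assms(4,5)) auto
  have inv: "invertible_mat (pencil r q \<alpha> w z)" if "z \<in> path_image \<gamma>" for z
    using mat_inv_inverse[OF pencil_carrier nz[OF that, unfolded pencil_char_def]]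
      pencil_carrier[of r q \<alpha> w z]
    unfolding invertible_mat_def inverts_mat_def by auto
  have "(\<Sum>l = 1..r. winding_number \<gamma> (node q \<alpha> l)) =
          (\<Sum>l = 1..r. if node q \<alpha> l \<in> inside (path_image \<gamma>) then 1 else 0)"
    using assms(10)
    by (intro sum.cong refl winding_number_positively_oriented[OF assms(7-9)])
  also have "\<dots> = of_nat ?N"
    by (simp add: nodes_inside_def sum.If_cases Int_def)
  finally have S: "(?S has_contour_integral 2 * pi * \<i> * of_nat ?N) \<gamma>"
    using has_contour_integral_sum_inverse[OF C1_path_imp_valid_path[OF assms(6)],
        of "{1..r}" "node q \<alpha>"] assms(10) by simp
  have L: "((\<lambda>z. deriv ?P z / ?P z) has_contour_integral 2 * pi * \<i> * of_nat ?N) \<gamma>"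
    using S by (rule has_contour_integral_eq) (simp add: pencil_char_logderiv nz)
  have T: "(?T has_contour_integral - (2 * pi * \<i> * of_nat ?N)) \<gamma>"
    using has_contour_integral_neg[OF S]
    by (rule has_contour_integral_eq) (simp add: trace_inverse_pencil_times_hankel nz)
  show ?thesis
    using nz inv has_contour_integral_integrable[OF L] has_contour_integral_integrable[OF T]
    by (simp add: contour_integral_unique[OF L] contour_integral_unique[OF T])
qed

end
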